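(* Let $n>1$ be an integer. Suppose the sequence $$state'_0\to state'_1\to\dots\to state'_k$$ is a solution of the missionaries and cannibals problem (MC). Then there exists a solution $$state_0\to state_1\to\dots\to state_k$$ of the jealous husbands problem (HW) such that, for each $j=0,1,\dots,k$, one has $state_j\in h(state'_j)$. Here $h:V'\to V/\!\sim$ is the map sending $state'=((c,m),(n-c,n-m),loc)$ to the $S_n$-orbit of the state $(L,R,loc)$ with $L=\{w_1,\dots,w_c,h_1,\dots,h_m\}$ and $R=U\setminus L$.
   Context: Boat capacity: in both problems the boat carries at most $b$ people, where $b=2$ if $n\le 3$, $b=3$ if $n\in\{4,5\}$, $b=4$ if $n\ge 6$. HW problem. Let $W=\{w_1,\dots,w_n\}$ be the set of wives, $H=\{h_1,\dots,h_n\}$ the set of husbands ($h_i$ is the husband of $w_i$), and $U=W\cup H$ ($2n$ distinct people). A subset $X\subseteq U$ is safe if either $X\cap H=\emptyset$, or for every $w_i\in X$ also $h_i\in X$. A state is a triple $(L,R,loc)$ with $L\subseteq U$, $R=U\setminus L$ (people on the left, resp. right bank), $loc\in\{left,right\}$ (the boat's location); it is admissible if both $L$ and $R$ are safe. Only admissible states are considered; $V$ is the set of all of them. A transition $(L_1,R_1,loc_1)\xrightarrow{f}(L_2,R_2,loc_2)$ between admissible states, with move $f=(B,loc_1)$, means: $loc_2\ne loc_1$, $B$ is a safe set of people with $0<|B|\le b$, and if $loc_1=left$ then $B\subseteq L_1$, $L_2=L_1\setminus B$, $R_2=R_1\cup B$, while if $loc_1=right$ then $B\subseteq R_1$, $R_2=R_1\setminus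 B$, $L_2=L_1\cup B$. A solution of HW is a finite sequence of states, consecutive ones joined by transitions, from $(U,\emptyset,left)$ to $(\emptyset,U,right)$. MC problem. A pair $(c,m)$ ($c$ cannibals, $m$ missionaries) of nonnegative integers is safe if $m=0$ or $c\le m$. A state is a triple $((c,m),(n-c,n-m),loc)$ with $0\le c,m\le n$, $loc\in\{left,right\}$ (left bank, right bank, boat's location); it is admissible if both pairs are safe. $V'$ is the set of admissible states. A transition $(L_1',R_1',loc_1)\to(L_2',R_2',loc_2)$ between admissible states, with move $(B',loc_1)$, means: $loc_2\neq loc_1$, $B'=(c,m)$ is a safe pair with $0<c+m\le b$, and $L_2'=L_1'-B'$, $R_2'=R_1'+B'$ (componentwise) if $loc_1=left$, while $R_2'=R_1'-B'$, $L_2'=L_1'+B'$ if $loc_1=right$. A solution of MC is a finite sequence of states, consecutive ones joined by transitions, from $((n,n),(0,0),left)$ to $((0,0),(n,n),right)$. Group action. For $X\subseteq U$ and $\pi\in S_n$ put $\pi X=\{w_{\pi(i)}\mid w_i\in X\}\cup\{h_{\pi(j)}\mid h_j\in X\}$, and $\pi(L,R,loc)=(\pi L,\pi R,loc)$; this is an action of $S_n$ on $V$, and $V/\!\sim$ is the set of its orbits. *)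

theory Defs
  imports "HOL-Algebra.Sym_Groups" "HOL-Algebra.Group_Action" "HOL-Library.Product_Plus"
begin

datatype bank = LeftBank | RightBank

definition boat_capacity :: "nat \<Rightarrow> nat" where
  "boat_capacity n = (if n \<le> 3 then 2 else if n \<le> 5 then 3 else 4)"

text \<open>A solution of a puzzle with admissible states \<open>V\<close> and transition relation \<open>step\<close>,
  leading from \<open>s\<close> to \<open>t\<close>; it is given as the list of its states.\<close>

definition is_solution :: "'s set \<Rightarrow> ('s \<Rightarrow> 's \<Rightarrow> bool) \<Rightarrow> 's \<Rightarrow> 's \<Rightarrow> 's list \<Rightarrow> bool" where
  "is_solution V step s t sts \<longleftrightarrow>
     sts \<noteq> [] \<and> set sts \<subseteq> V \<and> successively step sts \<and> hd sts = s \<and> last sts = t"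


section \<open>Jealous husbands\<close>

datatype person = Wife nat | Husband nat

type_synonym hw_state = "person set \<times> person set \<times> bank"

definition wives :: "nat \<Rightarrow> person set" where
  "wives n = Wife ` {1..n}"

definition husbands :: "nat \<Rightarrow> person set" where
  "husbands n = Husband ` {1..n}"

definition people :: "nat \<Rightarrow> person set" where
  "people n = wives n \<union> husbands n"

definition hw_safe :: "nat \<Rightarrow> person set \<Rightarrow> bool" where
  "hw_safe n X \<longleftrightarrow> X \<subseteq> people n \<and>
     (X \<inter> husbands n = {} \<or> (\<forall>i. Wife i \<in> X \<longrightarrow> Husband i \<in> X))"

definition hw_states :: "nat \<Rightarrow> hw_state set" where
  "hw_states n =
     {(L, R, loc). L \<subseteq> people n \<and> R = people n - L \<and> hw_safe n L \<and> hw_safe n R}"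

fun hw_step :: "nat \<Rightarrow> hw_state \<Rightarrow> hw_state \<Rightarrow> bool" where
  "hw_step n (L1, R1, loc1) (L2, R2, loc2) \<longleftrightarrow>
     (L1, R1, loc1) \<in> hw_states n \<and> (L2, R2, loc2) \<in> hw_states n \<and> loc2 \<noteq> loc1 \<and>
     (\<exists>B. hw_safe n B \<and> 0 < card B \<and> card B \<le> boat_capacity n \<and>
        (case loc1 of
           LeftBank \<Rightarrow> B \<subseteq> L1 \<and> L2 = L1 - B \<and> R2 = R1 \<union> B
         | RightBank \<Rightarrow> B \<subseteq> R1 \<and> R2 = R1 - B \<and> L2 = L1 \<union> B))"

definition hw_solution :: "nat \<Rightarrow> hw_state list \<Rightarrow> bool" where
  "hw_solution n =
     is_solution (hw_states n) (hw_step n) (people n, {}, LeftBank) ({}, people n, RightBank)"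


section \<open>Missionaries and cannibals\<close>

text \<open>The pair \<open>(c, m)\<close> stands for \<open>c\<close> cannibals and \<open>m\<close> missionaries.\<close>

type_synonym mc_state = "(nat \<times> nat) \<times> (nat \<times> nat) \<times> bank"

fun mc_safe :: "nat \<times> nat \<Rightarrow> bool" where
  "mc_safe (c, m) \<longleftrightarrow> m = 0 \<or> c \<le> m"

definition mc_states :: "nat \<Rightarrow> mc_state set" where
  "mc_states n =
     {((c, m), (n - c, n - m), loc) | c m loc.
        c \<le> n \<and> m \<le> n \<and> mc_safe (c, m) \<and> mc_safe (n - c, n - m)}"

text \<open>Addition and subtraction of pairs are componentwise. As subtraction on \<^typ>\<open>nat\<close> is
  truncated, the step relation also requires that nobody boards who is not on the bank
  the boat leaves from.\<close>

fun mc_step :: "nat \<Rightarrow> mc_state \<Rightarrow> mc_state \<Rightarrow> bool" where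
  "mc_step n (L1, R1, loc1) (L2, R2, loc2) \<longleftrightarrow>
     (L1, R1, loc1) \<in> mc_states n \<and> (L2, R2, loc2) \<in> mc_states n \<and> loc2 \<noteq> loc1 \<and>
     (\<exists>B. mc_safe B \<and> 0 < fst B + snd B \<and> fst B + snd B \<le> boat_capacity n \<and>
        (case loc1 of
           LeftBank \<Rightarrow>
             fst B \<le> fst L1 \<and> snd B \<le> snd L1 \<and> L2 = L1 - B \<and> R2 = R1 + B
         | RightBank \<Rightarrow>
             fst B \<le> fst R1 \<and> snd B \<le> snd R1 \<and> R2 = R1 - B \<and> L2 = L1 + B))"

definition mc_solution :: "nat \<Rightarrow> mc_state list \<Rightarrow> bool" where
  "mc_solution n =
     is_solution (mc_states n) (mc_step n)
       ((n, n), (0, 0), LeftBank) ((0, 0), (n, n), RightBank)"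


section \<open>The action of the symmetric group\<close>

fun perm_person :: "(nat \<Rightarrow> nat) \<Rightarrow> person \<Rightarrow> person" where
  "perm_person \<pi> (Wife i) = Wife (\<pi> i)"
| "perm_person \<pi> (Husband i) = Husband (\<pi> i)"

fun perm_state :: "(nat \<Rightarrow> nat) \<Rightarrow> hw_state \<Rightarrow> hw_state" where
  "perm_state \<pi> (L, R, loc) = (perm_person \<pi> ` L, perm_person \<pi> ` R, loc)"

text \<open>The restriction makes the bijections extensional, as the library's group actions are.\<close>

definition hw_action :: "nat \<Rightarrow> (nat \<Rightarrow> nat) \<Rightarrow> hw_state \<Rightarrow> hw_state" where
  "hw_action n \<pi> = restrict (perm_state \<pi>) (hw_states n)"

definition hw_orbits :: "nat \<Rightarrow> hw_state set set" where
  "hw_orbits n = orbits (sym_group n) (hw_states n) (hw_action n)"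

fun h_map :: "nat \<Rightarrow> mc_state \<Rightarrow> hw_state set" where
  "h_map n ((c, m), R', loc) =
     (let L = Wife ` {1..c} \<union> Husband ` {1..m}
      in orbit (sym_group n) (hw_action n) (L, people n - L, loc))"


section \<open>The action and the map are well defined\<close>

lemma perm_person_comp: "perm_person (\<pi> \<circ> \<rho>) x = perm_person \<pi> (perm_person \<rho> x)"
  by (cases x) auto

lemma perm_person_id: "perm_person id x = x"
  by (cases x) auto

lemma inj_perm_person:
  assumes "inj \<pi>"
  shows "inj (perm_person \<pi>)"
proof (rule injI)
  fix x y
  assume "perm_person \<pi> x = perm_person \<pi> y"
  then show "x = y"
    using assms by (cases x; cases y) (auto dest: injD)
qed

lemma perm_person_people:
  assumes "\<pi> permutes {1..n}"
  shows "perm_person \<pi> ` people n = people n"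
proof -
  have "perm_person \<pi> ` people n = Wife ` (\<pi> ` {1..n}) \<union> Husband ` (\<pi> ` {1..n})"
    by (simp add: people_def wives_def husbands_def image_Un image_image)
  then show ?thesis
    using permutes_image[OF assms] by (simp add: people_def wives_def husbands_def)
qed

lemma perm_person_husbands:
  assumes "\<pi> permutes {1..n}"
  shows "perm_person \<pi> ` husbands n = husbands n"
proof -
  have "perm_person \<pi> ` husbands n = Husband ` (\<pi> ` {1..n})"
    by (simp add: husbands_def image_image)
  then show ?thesis
    using permutes_image[OF assms] by (simp add: husbands_def)
qed

lemma hw_safe_perm:
  assumes \<pi>: "\<pi> permutes {1..n}" and X: "hw_safe n X"
  shows "hw_safe n (perm_person \<pi> ` X)"
proof -
  have sub: "perm_person \<pi> ` X \<subseteq> people n"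
    using X perm_person_people[OF \<pi>] unfolding hw_safe_def by blast
  have "inj (perm_person \<pi>)"
    using inj_perm_person permutes_inj[OF \<pi>] by blast
  then have int: "perm_person \<pi> ` X \<inter> husbands n = perm_person \<pi> ` (X \<inter> husbands n)"
    using perm_person_husbands[OF \<pi>] by (metis image_Int)
  have "Husband i \<in> perm_person \<pi> ` X"
    if all: "\<forall>i. Wife i \<in> X \<longrightarrow> Husband i \<in> X" and i: "Wife i \<in> perm_person \<pi> ` X" for i
  proof -
    obtain x where x: "x \<in> X" "Wife i = perm_person \<pi> x"
      using i by blast
    then obtain j where "x = Wife j" "i = \<pi> j"
      by (cases x) auto
    then show ?thesis
      using all x by (metis image_eqI perm_person.simps(2))
  qed
  then show ?thesis
    using X sub int unfolding hw_safe_def by auto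
qed

lemma perm_state_mem:
  assumes \<pi>: "\<pi> permutes {1..n}" and s: "s \<in> hw_states n"
  shows "perm_state \<pi> s \<in> hw_states n"
proof -
  obtain L loc where s_eq: "s = (L, people n - L, loc)" and L: "L \<subseteq> people n"
    and safe: "hw_safe n L" "hw_safe n (people n - L)"
    using s by (auto simp: hw_states_def)
  have "inj (perm_person \<pi>)"
    using inj_perm_person permutes_inj[OF \<pi>] by blast
  then have diff: "perm_person \<pi> ` (people n - L) = people n - perm_person \<pi> ` L"
    using perm_person_people[OF \<pi>] by (metis image_set_diff)
  have "hw_safe n (perm_person \<pi> ` L)" "hw_safe n (people n - perm_person \<pi> ` L)"
    using hw_safe_perm[OF \<pi>] safe diff by metis+
  then show ?thesis
    unfolding s_eq hw_states_def by (auto simp: diff hw_safe_def)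
qed

lemma perm_state_comp: "perm_state (\<pi> \<circ> \<rho>) s = perm_state \<pi> (perm_state \<rho> s)"
  by (cases s) (simp add: image_image perm_person_comp)

lemma perm_state_id: "perm_state id s = s"
  by (cases s) (simp add: perm_person_id)

lemma hw_action_Bij:
  assumes \<pi>: "\<pi> permutes {1..n}"
  shows "hw_action n \<pi> \<in> Bij (hw_states n)"
proof -
  let ?\<rho> = "inv' \<pi>"
  have \<rho>: "?\<rho> permutes {1..n}"
    using \<pi> by (rule permutes_inv)
  have "perm_state ?\<rho> (perm_state \<pi> s) = s" "perm_state \<pi> (perm_state ?\<rho> s) = s" for s
    using permutes_inv_o[OF \<pi>] perm_state_comp[of ?\<rho> \<pi> s] perm_state_comp[of \<pi> ?\<rho> s]
    by (simp_all add: perm_state_id)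
  then have "bij_betw (perm_state \<pi>) (hw_states n) (hw_states n)"
    using perm_state_mem[OF \<pi>] perm_state_mem[OF \<rho>]
    by (intro bij_betwI[where g = "perm_state ?\<rho>"]) auto
  then have "bij_betw (hw_action n \<pi>) (hw_states n) (hw_states n)"
    unfolding hw_action_def by (subst bij_betw_restrict_eq)
  then show ?thesis
    by (auto simp: Bij_def hw_action_def)
qed

lemma hw_group_action: "group_action (sym_group n) (hw_states n) (hw_action n)"
proof -
  have "hw_action n (\<pi> \<circ> \<rho>) = compose (hw_states n) (hw_action n \<pi>) (hw_action n \<rho>)"
    if "\<rho> permutes {1..n}" for \<pi> \<rho>
    using perm_state_mem[OF that]
    by (intro ext) (simp add: hw_action_def compose_def perm_state_comp restrict_def del: perm_state.simps)
  then have "hw_action n \<in> hom (sym_group n) (BijGroup (hw_states n))"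
    unfolding hom_def
    by (auto simp: BijGroup_def sym_group_def hw_action_Bij)
  then show ?thesis
    by (intro group_action.intro group_hom.intro)
      (auto simp: group_hom_axioms_def sym_group_is_group group_BijGroup)
qed

lemma h_map_mem_orbits:
  assumes "s' \<in> mc_states n"
  shows "h_map n s' \<in> hw_orbits n"
proof -
  obtain c m loc where s': "s' = ((c, m), (n - c, n - m), loc)"
    and le: "c \<le> n" "m \<le> n" and safe: "mc_safe (c, m)" "mc_safe (n - c, n - m)"
    using assms by (auto simp: mc_states_def)
  let ?L = "Wife ` {1..c} \<union> Husband ` {1..m}"
  have sub: "?L \<subseteq> people n"
    using le by (auto simp: people_def wives_def husbands_def)
  have safe_L: "hw_safe n ?L"
    using sub safe(1) by (auto simp: hw_safe_def husbands_def)
  have "m = n \<or> m \<le> c"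
    using safe(2) le by auto
  then have safe_R: "hw_safe n (people n - ?L)"
    using le by (auto simp: hw_safe_def people_def wives_def husbands_def)
  have "(?L, people n - ?L, loc) \<in> hw_states n"
    using sub safe_L safe_R by (simp add: hw_states_def)
  then show ?thesis
    unfolding s' hw_orbits_def orbits_def by (auto simp: Let_def)
qed

end

theory Submission
  imports Defs
begin

text \<open>In an admissible state of HW either all husbands are on one bank, or each bank
  is a union of couples. Hence the orbit of a state is determined by the number of wives and of
  husbands on the left bank, and \<open>h(state')\<close> consists of all admissible states with the numbers
  given by \<open>state'\<close>. A move of MC lifts to any of these states: choose any
  admissible set of the required size to stay on the bank which the boat leaves; if husbands board
  at all, then the wives who board turn out to be accompanied by their husbands. Lifting one move after the other gives the
  solution of HW.\<close>

section \<open>States described by index sets of wives and husbands\<close>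

definition bank_of :: "nat set \<Rightarrow> nat set \<Rightarrow> person set" where
  "bank_of A D = Wife ` A \<union> Husband ` D"

definition config :: "nat \<Rightarrow> nat set \<Rightarrow> nat set \<Rightarrow> bank \<Rightarrow> hw_state" where
  "config n A D loc = (bank_of A D, bank_of ({1..n} - A) ({1..n} - D), loc)"

text \<open>Safety of the left bank means \<open>D = {}\<close> or \<open>A \<subseteq> D\<close>,
  that of the right bank \<open>D = {1..n}\<close> or \<open>D \<subseteq> A\<close>; together they
  reduce to this disjunction, which is symmetric under complements.\<close>

definition admissible :: "nat \<Rightarrow> nat set \<Rightarrow> nat set \<Rightarrow> bool" where
  "admissible n A D \<longleftrightarrow> A \<subseteq> {1..n} \<and> D \<subseteq> {1..n} \<and> (D = {} \<or> D = {1..n} \<or> A = D)"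

lemma admissible_compl: "admissible n A D \<Longrightarrow> admissible n ({1..n} - A) ({1..n} - D)"
  by (auto simp: admissible_def)

lemma people_diff_bank_of: "people n - bank_of A D = bank_of ({1..n} - A) ({1..n} - D)"
  by (auto simp: people_def wives_def husbands_def bank_of_def)

lemma bank_of_diff: "bank_of A D - bank_of A' D' = bank_of (A - A') (D - D')"
  by (auto simp: bank_of_def)

lemma bank_of_Un: "bank_of A D \<union> bank_of A' D' = bank_of (A \<union> A') (D \<union> D')"
  by (auto simp: bank_of_def)

lemma bank_of_mono: "A \<subseteq> A' \<Longrightarrow> D \<subseteq> D' \<Longrightarrow> bank_of A D \<subseteq> bank_of A' D'"
  by (auto simp: bank_of_def)

lemma card_bank_of:
  assumes "finite A" "finite D"
  shows "card (bank_of A D) = card A + card D"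
proof -
  have "card (Wife ` A \<union> Husband ` D) = card (Wife ` A) + card (Husband ` D)"
    using assms by (intro card_Un_disjoint) auto
  then show ?thesis
    by (simp add: bank_of_def card_image inj_on_def)
qed

lemma hw_safe_bank_of:
  assumes "A \<subseteq> {1..n}" "D \<subseteq> {1..n}" "D = {} \<or> A \<subseteq> D"
  shows "hw_safe n (bank_of A D)"
  using assms by (auto simp: hw_safe_def bank_of_def people_def wives_def husbands_def)

lemma config_mem_hw_states:
  assumes "admissible n A D"
  shows "config n A D loc \<in> hw_states n"
proof -
  have "hw_safe n (bank_of A D)" if "admissible n A D" for A D
    using that by (intro hw_safe_bank_of) (auto simp: admissible_def)
  from this[OF assms] this[OF admissible_compl[OF assms]] show ?thesis
    by (auto simp: hw_states_def config_def people_diff_bank_of hw_safe_def)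
qed

section \<open>Orbits under permutations\<close>

text \<open>A bijection from \<open>A\<close> to \<open>B\<close> is glued to one between the
  complements in \<open>S\<close>, which have equal size as \<open>S\<close> is finite, and extended
  by the identity outside \<open>S\<close>.\<close>

lemma ex_permutes_image:
  assumes "finite S" "A \<subseteq> S" "B \<subseteq> S" "card A = card B"
  shows "\<exists>p. p permutes S \<and> p ` A = B"
proof -
  have fin: "finite A" "finite B"
    using assms finite_subset by auto
  obtain f where f: "bij_betw f A B"
    using finite_same_card_bij[OF fin assms(4)] by blast
  have "card (S - A) = card (S - B)"
    using assms fin by (simp add: card_Diff_subset)
  then obtain g where g: "bij_betw g (S - A) (S - B)"
    using finite_same_card_bij[of "S - A" "S - B"] assms(1) by blast
  let ?p = "\<lambda>x. if x \<in> A then f x else if x \<in> S then g x else x"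
  have p1: "bij_betw ?p A B"
    using f by (simp cong: bij_betw_cong)
  have p2: "bij_betw ?p (S - A) (S - B)"
    using g by (subst bij_betw_cong[of _ _ g]) auto
  have "bij_betw ?p (A \<union> (S - A)) (B \<union> (S - B))"
    using p1 p2 by (rule bij_betw_combine) auto
  moreover have "A \<union> (S - A) = S" "B \<union> (S - B) = S"
    using assms by auto
  ultimately have "bij_betw ?p S S"
    by simp
  then have "?p permutes S"
    using assms(2) by (rule_tac bij_imp_permutes) auto
  then show ?thesis
    using bij_betw_imp_surj_on[OF p1] by blast
qed

lemma perm_person_bank_of: "perm_person \<pi> ` bank_of A D = bank_of (\<pi> ` A) (\<pi> ` D)"
  by (simp add: bank_of_def image_Un image_image)

text \<open>The representative chosen by \<open>h_map\<close> is
  \<open>config n {1..card A} {1..card D} loc\<close>. A permutation carrying its wives to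
  \<open>A\<close> automatically carries its husbands to \<open>D\<close>: every permutation
  preserves the empty set and \<open>{1..n}\<close>, and otherwise \<open>A = D\<close>.\<close>

lemma config_mem_h_map:
  assumes "admissible n A D"
  shows "config n A D loc \<in> h_map n ((card A, card D), R', loc)"
proof -
  let ?A = "{1..card A}" and ?D = "{1..card D}"
  have sub: "A \<subseteq> {1..n}" "D \<subseteq> {1..n}" and cases: "D = {} \<or> D = {1..n} \<or> A = D"
    using assms by (auto simp: admissible_def)
  have "card A \<le> n" "card D \<le> n"
    using card_mono[of "{1..n}"] sub by fastforce+
  then have sub': "?A \<subseteq> {1..n}" "?D \<subseteq> {1..n}"
    by auto
  have adm: "admissible n ?A ?D"
    using sub' cases by (auto simp: admissible_def)
  obtain \<pi> where \<pi>: "\<pi> permutes {1..n}" and im: "\<pi> ` ?A = A"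
    using ex_permutes_image[of "{1..n}" ?A A] sub sub' by auto
  have im': "\<pi> ` ?D = D"
    using cases im permutes_image[OF \<pi>] by auto
  have diff: "\<pi> ` ({1..n} - X) = {1..n} - \<pi> ` X" for X
    using permutes_image[OF \<pi>] by (metis image_set_diff permutes_inj[OF \<pi>])
  have "perm_state \<pi> (config n ?A ?D loc) = config n A D loc"
    by (simp add: config_def perm_person_bank_of im im' diff del: One_nat_def)
  then have "hw_action n \<pi> (config n ?A ?D loc) = config n A D loc"
    using config_mem_hw_states[OF adm] by (simp add: hw_action_def)
  then have "config n A D loc \<in> orbit (sym_group n) (hw_action n) (config n ?A ?D loc)"
    using \<pi> unfolding orbit_def sym_group_def by force
  moreover have "config n ?A ?D loc = (bank_of ?A ?D, people n - bank_of ?A ?D, loc)"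
    by (simp add: config_def people_diff_bank_of)
  ultimately show ?thesis
    by (simp add: Let_def bank_of_def)
qed

section \<open>Lifting a single move\<close>

text \<open>\<open>A'\<close> and \<open>D'\<close> stay behind; the last conjunct makes the boat
  load safe. The condition on \<open>c\<close> and \<open>m\<close> is admissibility read on
  numbers. The cases are that no husband leaves, that all do, and that only some do.\<close>

lemma ex_departure:
  assumes adm: "admissible n A D"
    and le: "c \<le> card A" "m \<le> card D"
    and mc: "m = 0 \<or> m = n \<or> c = m"
  shows "\<exists>A' D'. A' \<subseteq> A \<and> D' \<subseteq> D \<and> card A' = c \<and> card D' = m \<and> admissible n A' D' \<and>
           (D - D' = {} \<or> A - A' \<subseteq> D - D')"
proof -
  have sub: "A \<subseteq> {1..n}" "D \<subseteq> {1..n}" and cases: "D = {} \<or> D = {1..n} \<or> A = D"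
    using adm by (auto simp: admissible_def)
  have fin: "finite A" "finite D"
    using sub finite_subset by blast+
  obtain A' where A': "A' \<subseteq> A" "card A' = c"
    using obtain_subset_with_card_n[OF le(1)] by blast
  consider "m = card D" | "m = 0" "m < card D" | "0 < m" "m < card D"
    using le(2) by linarith
  then show ?thesis
  proof cases
    case 1
    \<comment> \<open>A proper nonempty \<open>D\<close> equals \<open>A\<close>, and
      \<open>0 < m < n\<close> forces \<open>c = m\<close>, so no wife leaves either.\<close>
    have "A' = D" if "D \<noteq> {}" "D \<noteq> {1..n}"
    proof -
      have "A = D"
        using cases that by blast
      moreover have "m \<noteq> n" "m \<noteq> 0"
        using that sub fin card_subset_eq[of "{1..n}" D] 1 by auto
      ultimately show ?thesis
        using A' mc 1 fin card_subset_eq[of A A'] by simp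
    qed
    then have "admissible n A' D"
      using sub A' unfolding admissible_def by blast
    with 1 A' show ?thesis
      by blast
  next
    case 2
    \<comment> \<open>Some husband is present, so every wife on this bank has hers there; as all
      husbands board, a wife who boards is accompanied.\<close>
    then have "A \<subseteq> D"
      using cases sub by auto
    then show ?thesis
      using A' 2 sub by (intro exI[of _ A'] exI[of _ "{}"]) (auto simp: admissible_def)
  next
    case 3
    moreover have "card D \<le> n"
      using sub card_mono[of "{1..n}" D] by simp
    ultimately have "c = m"
      using mc by simp
    moreover have "A \<subseteq> D"
      using cases sub 3 by auto
    \<comment> \<open>As many wives as husbands stay, so whole couples can be kept: one set serves
      as both \<open>A'\<close> and \<open>D'\<close>.\<close>
    ultimately show ?thesis
      using A' sub by (intro exI[of _ A'] exI[of _ A']) (auto simp: admissible_def)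
  qed
qed

text \<open>The invariant of the simulation. It uses explicit index sets, from which the next move
  can be built; orbit membership is recovered by \<open>config_mem_h_map\<close>.\<close>

inductive lifts :: "nat \<Rightarrow> mc_state \<Rightarrow> hw_state \<Rightarrow> bool" for n where
  "admissible n A D \<Longrightarrow>
     lifts n ((card A, card D), (n - card A, n - card D), loc) (config n A D loc)"

text \<open>The counts of \<open>t'\<close> fix how many people stay on the bank the boat leaves,
  \<open>ex_departure\<close> selects them, and the boat takes the rest. On a return trip it is
  applied to the complements, so the selected sets form the new right bank.\<close>

lemma lifts_step:
  assumes "lifts n s' s" and step: "mc_step n s' t'"
  shows "\<exists>t. lifts n t' t \<and> hw_step n s t"
  using assms(1)
proof cases
  case (1 A D loc)
  have sub: "A \<subseteq> {1..n}" "D \<subseteq> {1..n}"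
    using 1(3) by (auto simp: admissible_def)
  have card_compl: "card ({1..n} - X) = n - card X" if "X \<subseteq> {1..n}" for X
    using that by (simp add: card_Diff_subset finite_subset)
  obtain c m loc' where t': "t' = ((c, m), (n - c, n - m), loc')"
    and le: "c \<le> n" "m \<le> n" and safe: "mc_safe (c, m)" "mc_safe (n - c, n - m)"
    using step by (cases s'; cases t') (auto simp: mc_states_def)
  have loc': "loc' \<noteq> loc"
    using step by (simp add: 1 t')
  obtain dc dm where boat: "0 < dc + dm" "dc + dm \<le> boat_capacity n"
    and moves: "case loc of
         LeftBank \<Rightarrow> dc \<le> card A \<and> dm \<le> card D \<and> c = card A - dc \<and> m = card D - dm
       | RightBank \<Rightarrow> dc \<le> n - card A \<and> dm \<le> n - card D \<and>
           n - c = n - card A - dc \<and> n - m = n - card D - dm"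
    using step unfolding 1 t' by (cases loc) auto
  \<comment> \<open>The first safety condition gives \<open>m = 0\<close> or
    \<open>c \<le> m\<close>, the second \<open>m = n\<close> or \<open>m \<le> c\<close>.\<close>
  have mc: "m = 0 \<or> m = n \<or> c = m"
    using safe le by auto
  show ?thesis
  proof (cases loc)
    case LeftBank
    have "c \<le> card A" "m \<le> card D"
      using moves LeftBank by auto
    from ex_departure[OF 1(3) this mc]
    obtain A' D' where A': "A' \<subseteq> A" "card A' = c" and D': "D' \<subseteq> D" "card D' = m"
      and adm: "admissible n A' D'" and B: "D - D' = {} \<or> A - A' \<subseteq> D - D'"
      by blast
    let ?B = "bank_of (A - A') (D - D')"
    have "card ?B = dc + dm"
      using moves LeftBank A' D' sub
      by (simp add: card_bank_of card_Diff_subset finite_subset[of _ "{1..n}"])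
    moreover have "hw_safe n ?B"
      using sub B by (intro hw_safe_bank_of) auto
    moreover have "A - (A - A') = A'" "D - (D - D') = D'"
      "{1..n} - A \<union> (A - A') = {1..n} - A'" "{1..n} - D \<union> (D - D') = {1..n} - D'"
      using A' D' sub by auto
    moreover have "?B \<subseteq> bank_of A D"
      by (intro bank_of_mono) auto
    ultimately have "hw_step n s (config n A' D' loc')"
      using config_mem_hw_states[OF 1(3)] config_mem_hw_states[OF adm] boat loc'
      unfolding 1 config_def LeftBank hw_step.simps
      by - (intro conjI exI[of _ ?B],
        simp_all add: bank_of_diff bank_of_Un del: One_nat_def)
    moreover have "lifts n t' (config n A' D' loc')"
      using lifts.intros[OF adm] A' D' t' by metis
    ultimately show ?thesis
      by blast
  next
    case RightBank
    let ?N = "{1..n}"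
    have "n - c \<le> card (?N - A)" "n - m \<le> card (?N - D)"
      using moves RightBank sub by (auto simp: card_compl simp del: One_nat_def)
    moreover have "n - m = 0 \<or> n - m = n \<or> n - c = n - m"
      using mc by auto
    ultimately obtain A' D' where A': "A' \<subseteq> ?N - A" "card A' = n - c"
      and D': "D' \<subseteq> ?N - D" "card D' = n - m"
      and adm: "admissible n A' D'" and B: "?N - D - D' = {} \<or> ?N - A - A' \<subseteq> ?N - D - D'"
      using ex_departure[OF admissible_compl[OF 1(3)]] by meson
    let ?B = "bank_of (?N - A - A') (?N - D - D')"
    have sub': "A' \<subseteq> ?N" "D' \<subseteq> ?N"
      using A' D' by auto
    have "card (?N - A - A') = n - card A - (n - c)" "card (?N - D - D') = n - card D - (n - m)"
      using A' D' sub sub'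
      by (simp_all add: card_Diff_subset finite_subset[of _ ?N] del: One_nat_def)
    \<comment> \<open>Truncation does no harm: \<open>dc\<close> and \<open>dm\<close> do not exceed
      the numbers on the right bank, so subtracting twice recovers them.\<close>
    moreover have "n - card A - (n - c) = dc" "n - card D - (n - m) = dm"
      using moves unfolding RightBank bank.case by (metis diff_diff_cancel)+
    ultimately have "card ?B = dc + dm"
      by (simp add: card_bank_of del: One_nat_def)
    moreover have "hw_safe n ?B"
      using sub B by (intro hw_safe_bank_of) auto
    moreover have "?N - A - (?N - A - A') = A'" "?N - D - (?N - D - D') = D'"
      "A \<union> (?N - A - A') = ?N - A'" "D \<union> (?N - D - D') = ?N - D'"
      "?N - (?N - A') = A'" "?N - (?N - D') = D'"
      using A' D' sub by auto
    moreover have "?B \<subseteq> bank_of (?N - A) (?N - D)"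
      by (intro bank_of_mono) auto
    moreover note adm' = admissible_compl[OF adm]
    ultimately have "hw_step n s (config n (?N - A') (?N - D') loc')"
      using config_mem_hw_states[OF 1(3)] config_mem_hw_states[OF adm'] boat loc'
      unfolding 1 config_def RightBank hw_step.simps
      by - (intro conjI exI[of _ ?B],
        simp_all add: bank_of_diff bank_of_Un del: One_nat_def)
    moreover have "card (?N - A') = c" "card (?N - D') = m"
      using A' D' sub' le by (auto simp: card_compl simp del: One_nat_def)
    then have "lifts n t' (config n (?N - A') (?N - D') loc')"
      using lifts.intros[OF adm'] t' by metis
    ultimately show ?thesis
      by blast
  qed
qed

section \<open>Lifting a whole solution\<close>

text \<open>Each lifted step depends on the state already reached, so the run is built along the
  list, with both current states generalised. \<open>list_all2\<close> delivers equal length and the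
  relation at each index at once.\<close>

lemma successively_simulation:
  assumes sim: "\<And>s' s t'. R s' s \<Longrightarrow> step' s' t' \<Longrightarrow> \<exists>t. R t' t \<and> step s t"
    and "successively step' (s' # xs')" "R s' s"
  shows "\<exists>xs. successively step (s # xs) \<and> list_all2 R (s' # xs') (s # xs)"
  using assms(2,3)
proof (induction xs' arbitrary: s' s)
  case Nil
  then show ?case
    by auto
next
  case (Cons t' xs')
  then obtain t where "R t' t" "step s t"
    using sim by (metis successively.simps(3))
  moreover obtain xs where "successively step (t # xs)" "list_all2 R (t' # xs') (t # xs)"
    using Cons.IH[of t' t] Cons.prems(1) \<open>R t' t\<close> by auto
  ultimately show ?case
    using Cons.prems(2) by (intro exI[of _ "t # xs"]) auto
qed

theorem theorem2:
  fixes n :: nat and sts' :: "mc_state list"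
  assumes "n > 1"
    and "mc_solution n sts'"
  shows "\<exists>sts. hw_solution n sts \<and> length sts = length sts' \<and>
           (\<forall>j < length sts'. sts ! j \<in> h_map n (sts' ! j))"
proof -
  let ?s' = "((n, n), (0, 0), LeftBank)" and ?s = "(people n, {}, LeftBank)"
  obtain xs' where sts': "sts' = ?s' # xs'" and succ: "successively (mc_step n) (?s' # xs')"
    and last': "last sts' = ((0, 0), (n, n), RightBank)"
    using assms(2) by (cases sts') (auto simp: mc_solution_def is_solution_def)
  have people: "bank_of {1..n} {1..n} = people n" "bank_of {} {} = {}"
    by (simp_all add: bank_of_def people_def wives_def husbands_def)
  have "admissible n {1..n} {1..n}"
    by (simp add: admissible_def)
  from lifts.intros[OF this, of LeftBank] have start: "lifts n ?s' ?s"
    by (simp add: config_def people del: One_nat_def)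
  have "\<exists>xs. successively (hw_step n) (?s # xs) \<and> list_all2 (lifts n) (?s' # xs') (?s # xs)"
    using lifts_step succ start by (rule successively_simulation)
  then obtain xs where xs: "successively (hw_step n) (?s # xs)"
    and rel: "list_all2 (lifts n) sts' (?s # xs)"
    unfolding sts' by blast
  have len: "length (?s # xs) = length sts'"
    using rel by (metis list_all2_lengthD)
  have "lifts n (sts' ! (length sts' - 1)) ((?s # xs) ! (length (?s # xs) - 1))"
    unfolding len using rel by (rule list_all2_nthD) (simp add: sts')
  then have "lifts n (last sts') (last (?s # xs))"
    unfolding sts' by (metis last_conv_nth list.distinct(1))
  then have last: "last (?s # xs) = ({}, people n, RightBank)"
    unfolding last'
  proof cases
    case (1 A D)
    \<comment> \<open>Both sets have cardinality 0 and are finite as subsets of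
      \<open>{1..n}\<close>, hence empty, so the lifted run ends exactly in the goal.\<close>
    then have "A = {}" "D = {}"
      using finite_subset[of _ "{1..n}"] by (auto simp: admissible_def)
    then show ?thesis
      using 1 by (simp add: config_def people del: One_nat_def)
  qed
  have "t \<in> hw_states n \<and> t \<in> h_map n t'" if "lifts n t' t" for t' t
    using that
    by cases (use config_mem_hw_states config_mem_h_map in blast)
  then have mem: "(?s # xs) ! j \<in> hw_states n \<and> (?s # xs) ! j \<in> h_map n (sts' ! j)"
    if "j < length sts'" for j
    using rel that by (meson list_all2_nthD)
  have "set (?s # xs) \<subseteq> hw_states n"
    using mem len by (metis in_set_conv_nth subsetI)
  then have "hw_solution n (?s # xs)"
    using xs last by (simp add: hw_solution_def is_solution_def)
  with len mem show ?thesis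
    by blast
qed

end
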